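(* Assume $H^\star\ne0$ and define, for $\Delta\ge0$, $$d_{\rm curv}(\Delta):=\frac{\sum_i\ell_i(\Delta)}{\ell_{\rm full}(\Delta)},\qquad d_H:=\frac{\operatorname{tr}H^\star}{\|H^\star\|_2},\qquad d_A:=\frac{\sum_i\rho_i^2}{\rho^2}.$$ With $\Delta_{\rm cross}:=\gamma^2\log2\,\|H^\star\|_2/\rho^2$, $$d_{\rm curv}(\Delta)=\frac{\Delta_{\rm cross}}{\Delta_{\rm cross}+\Delta}\,d_H+\frac{\Delta}{\Delta_{\rm cross}+\Delta}\,d_A .$$ Both $d_H$ and $d_A$ lie in $[1,m]$, and $d_{\rm curv}(0)=d_H$ and $d_{\rm curv}(\Delta)\to d_A$ as $\Delta\to\infty$.
   Context: Let $A\in\mathbb R^{m\times n}$ with columns $a_1,\dots,a_n$ and rows $A_{i:}$, $b\in\mathbb R^m$, $c\in\mathbb R^n$, $\gamma>0$. Standing assumption: there is $q\in\mathbb R^m$ with $A^\top q=\mathbf 1$ and $\langle q,b\rangle=1$, and there is $\bar x>0$ (entrywise) with $A\bar x=b$. $\phi_{\rm se}(\lambda)=-\langle b,\lambda\rangle+\gamma\sum_j\exp((a_j^\top\lambda-c_j)/\gamma)$ attains its minimum, and $H^\star=\nabla^2\phi_{\rm se}(\lambda^\star)$ at a minimizer (independent of the choice of minimizer). $\rho_i=\|A_{i:}\|_\infty=\max_j|A_{ij}|$ and $\rho=\max_j\|a_j\|_2$. The envelopes are $\ell_i(\Delta)=2\log2\,H^\star_{ii}+2\Delta\rho_i^2/\gamma^2$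 for $i=1,\dots,m$ and $\ell_{\rm full}(\Delta)=2\log2\,\|H^\star\|_2+2\Delta\rho^2/\gamma^2$, with $\|\cdot\|_2$ the spectral norm. *)

theory Defs
  imports "HOL-Analysis.Analysis"
begin

definition partial_deriv :: "'m::finite \<Rightarrow> (real^'m \<Rightarrow> real) \<Rightarrow> real^'m \<Rightarrow> real" where
  "partial_deriv i f x = deriv (\<lambda>t. f (x + t *\<^sub>R axis i 1)) 0"

definition hessian :: "(real^'m::finite \<Rightarrow> real) \<Rightarrow> real^'m \<Rightarrow> real^'m^'m" where
  "hessian f x = (\<chi> i j. partial_deriv i (partial_deriv j f) x)"

(* onorm is taken with respect to the Euclidean norm on real^'m. *)
definition spectral_norm :: "real^'m::finite^'m \<Rightarrow> real" where
  "spectral_norm M = onorm ((*v) M)"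

definition phi_se ::
  "real^'n::finite^'m::finite \<Rightarrow> real^'m \<Rightarrow> real^'n \<Rightarrow> real \<Rightarrow> real^'m \<Rightarrow> real" where
  "phi_se A b c \<gamma> lam =
     - (b \<bullet> lam) + \<gamma> * (\<Sum>j\<in>UNIV. exp ((column j A \<bullet> lam - c $ j) / \<gamma>))"

definition rho_row :: "real^'n::finite^'m::finite \<Rightarrow> 'm \<Rightarrow> real" where
  "rho_row A i = infnorm (row i A)"

definition rho :: "real^'n::finite^'m::finite \<Rightarrow> real" where
  "rho A = Max (range (\<lambda>j. norm (column j A)))"

(* In the definitions below, H stands for the Hessian of phi_se at a minimizer. *)

definition ell ::
  "real^'n::finite^'m::finite \<Rightarrow> real \<Rightarrow> real^'m^'m \<Rightarrow> 'm \<Rightarrow> real \<Rightarrow> real" where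
  "ell A \<gamma> H i \<Delta> = 2 * ln 2 * H $ i $ i + 2 * \<Delta> * (rho_row A i)\<^sup>2 / \<gamma>\<^sup>2"

definition ell_full ::
  "real^'n::finite^'m::finite \<Rightarrow> real \<Rightarrow> real^'m^'m \<Rightarrow> real \<Rightarrow> real" where
  "ell_full A \<gamma> H \<Delta> = 2 * ln 2 * spectral_norm H + 2 * \<Delta> * (rho A)\<^sup>2 / \<gamma>\<^sup>2"

definition d_curv ::
  "real^'n::finite^'m::finite \<Rightarrow> real \<Rightarrow> real^'m^'m \<Rightarrow> real \<Rightarrow> real" where
  "d_curv A \<gamma> H \<Delta> = (\<Sum>i\<in>UNIV. ell A \<gamma> H i \<Delta>) / ell_full A \<gamma> H \<Delta>"

definition d_H :: "real^'m::finite^'m \<Rightarrow> real" where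
  "d_H H = trace H / spectral_norm H"

definition d_A :: "real^'n::finite^'m::finite \<Rightarrow> real" where
  "d_A A = (\<Sum>i\<in>UNIV. (rho_row A i)\<^sup>2) / (rho A)\<^sup>2"

definition Delta_cross :: "real^'n::finite^'m::finite \<Rightarrow> real \<Rightarrow> real^'m^'m \<Rightarrow> real" where
  "Delta_cross A \<gamma> H = \<gamma>\<^sup>2 * ln 2 * spectral_norm H / (rho A)\<^sup>2"

end

theory Submission
  imports Defs "HOL-Real_Asymp.Real_Asymp"
begin

text \<open>
  Differentiating the sum of exponentials twice shows that the Hessian is a nonnegatively
  weighted Gram matrix: \<open>H\<close> is the sum of \<open>w\<^sub>k a\<^sub>k a\<^sub>k\<^sup>T\<close> over the columns \<open>a\<^sub>k\<close>, with
  \<open>w\<^sub>k = exp ((a\<^sub>k \<bullet> lam - c\<^sub>k) / \<gamma>) / \<gamma>\<close> (lemma \<open>hessian_phi_se\<close>).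

  The bounds on \<open>d_H\<close> come from this form. A diagonal entry of any matrix is at most the
  spectral norm, so the trace is at most \<open>m\<close> times that norm; and the rank-one
  matrix \<open>a\<^sub>k a\<^sub>k\<^sup>T\<close> has spectral norm equal to its trace \<open>\<parallel>a\<^sub>k\<parallel>\<^sup>2\<close>, so the triangle inequality
  bounds the spectral norm of \<open>H\<close> by its trace (lemma \<open>spectral_norm_gram_le_trace\<close>).
  The bounds on \<open>d_A\<close> are the elementary comparison of the largest entries of the rows with
  the lengths of the columns.

  The interpolation formula is algebra: \<open>ell\<close> and \<open>ell_full\<close> are affine in \<open>\<Delta>\<close>, so \<open>d_curv\<close> is a
  mediant of the two ratios \<open>d_H\<close> and \<open>d_A\<close>, and \<open>Delta_cross\<close> is the value of \<open>\<Delta>\<close> at which the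
  two summands of \<open>ell_full\<close> are equal. The limit then follows because the second of the
  two weights tends to 1 and the first to 0.
\<close>

section \<open>The Hessian of the smoothed dual objective\<close>

lemma partial_deriv_eqI:
  assumes "((\<lambda>t. f (x + t *\<^sub>R axis i 1)) has_real_derivative d) (at 0)"
  shows "partial_deriv i f x = d"
  unfolding partial_deriv_def using assms by (rule DERIV_imp_deriv)

lemma column_inner_axis: "column k A \<bullet> axis i 1 = A $ i $ k" for A :: "real^'n^'m::finite"
  by (simp add: inner_axis column_def)

lemma partial_deriv_phi_se:
  fixes A :: "real^'n::finite^'m::finite"
  assumes "\<gamma> > 0"
  shows "partial_deriv j (phi_se A b c \<gamma>) x =
    - b $ j + (\<Sum>k\<in>UNIV. A $ j $ k * exp ((column k A \<bullet> x - c $ k) / \<gamma>))"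
proof (rule partial_deriv_eqI)
  show "((\<lambda>t. phi_se A b c \<gamma> (x + t *\<^sub>R axis j 1)) has_real_derivative
      - b $ j + (\<Sum>k\<in>UNIV. A $ j $ k * exp ((column k A \<bullet> x - c $ k) / \<gamma>))) (at 0)"
    unfolding phi_se_def using assms
    by (auto intro!: derivative_eq_intros sum.cong
        simp: inner_add_right inner_axis column_def sum_distrib_left)
qed

lemma hessian_phi_se:
  fixes A :: "real^'n::finite^'m::finite"
  assumes "\<gamma> > 0"
  shows "hessian (phi_se A b c \<gamma>) x $ i $ j =
    (\<Sum>k\<in>UNIV. exp ((column k A \<bullet> x - c $ k) / \<gamma>) / \<gamma> * (A $ i $ k * A $ j $ k))"
proof -
  have "partial_deriv i (partial_deriv j (phi_se A b c \<gamma>)) x =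
      (\<Sum>k\<in>UNIV. exp ((column k A \<bullet> x - c $ k) / \<gamma>) / \<gamma> * (A $ i $ k * A $ j $ k))"
    unfolding partial_deriv_phi_se[OF assms, abs_def]
    by (rule partial_deriv_eqI) (use assms in \<open>auto intro!: derivative_eq_intros sum.cong
        simp: inner_add_right column_inner_axis\<close>)
  then show ?thesis
    by (simp add: hessian_def)
qed

section \<open>Spectral norm and trace\<close>

lemma spectral_norm_pos:
  fixes M :: "real^'m::finite^'m"
  assumes "M \<noteq> 0"
  shows "spectral_norm M > 0"
proof -
  have "\<exists>x. M *v x \<noteq> 0"
    using assms matrix_eq[of M 0] by auto
  then show ?thesis
    unfolding spectral_norm_def by (simp add: onorm_pos_lt)
qed

lemma diag_le_spectral_norm:
  fixes M :: "real^'m::finite^'m"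
  shows "M $ i $ i \<le> spectral_norm M"
proof -
  have "M $ i $ i = (M *v axis i 1) $ i"
    by (simp add: matrix_vector_mul_component inner_axis)
  also have "\<dots> \<le> norm (M *v axis i 1)"
    using component_le_norm_cart[of "M *v axis i 1" i] by linarith
  also have "\<dots> \<le> spectral_norm M * norm (axis i 1 :: real^'m)"
    unfolding spectral_norm_def by (rule onorm) simp
  finally show ?thesis
    by simp
qed

lemma trace_le_card_spectral_norm:
  fixes M :: "real^'m::finite^'m"
  shows "trace M \<le> real CARD('m) * spectral_norm M"
  unfolding trace_def by (rule sum_bounded_above) (rule diag_le_spectral_norm)

text \<open>
  Applied to a vector \<open>x\<close>, the Gram matrix gives the combination of the columns \<open>a\<^sub>k\<close> with coefficients
  \<open>w\<^sub>k (a\<^sub>k \<bullet> x)\<close>. By Cauchy-Schwarz each term has length at most \<open>w\<^sub>k \<parallel>a\<^sub>k\<parallel>\<^sup>2 \<parallel>x\<parallel>\<close>, and the sum of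
  the numbers \<open>w\<^sub>k \<parallel>a\<^sub>k\<parallel>\<^sup>2\<close> is the trace. This avoids diagonalising the matrix.
\<close>
lemma spectral_norm_gram_le_trace:
  fixes A :: "real^'n::finite^'m::finite" and M :: "real^'m^'m"
  assumes gram: "\<And>i j. M $ i $ j = (\<Sum>k\<in>UNIV. w k * (A $ i $ k * A $ j $ k))"
    and nonneg: "\<And>k. w k \<ge> 0"
  shows "spectral_norm M \<le> trace M"
proof -
  have "trace M = (\<Sum>k\<in>UNIV. \<Sum>i\<in>UNIV. w k * (A $ i $ k * A $ i $ k))"
    unfolding trace_def gram by (rule sum.swap)
  also have "\<dots> = (\<Sum>k\<in>UNIV. w k * (norm (column k A))\<^sup>2)"
    by (simp add: power2_norm_eq_inner inner_vec_def column_def sum_distrib_left)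
  finally have tr: "trace M = (\<Sum>k\<in>UNIV. w k * (norm (column k A))\<^sup>2)" .
  have "norm (M *v x) \<le> trace M * norm x" for x
  proof -
    have "M *v x = (\<Sum>k\<in>UNIV. (w k * (column k A \<bullet> x)) *\<^sub>R column k A)"
    proof (rule vec_eq_iff[THEN iffD2, rule_format])
      fix i
      have "(M *v x) $ i = (\<Sum>j\<in>UNIV. \<Sum>k\<in>UNIV. w k * (A $ i $ k * A $ j $ k) * x $ j)"
        by (simp add: matrix_vector_mult_def gram sum_distrib_right)
      also have "\<dots> = (\<Sum>k\<in>UNIV. \<Sum>j\<in>UNIV. w k * (A $ i $ k * A $ j $ k) * x $ j)"
        by (rule sum.swap)
      also have "\<dots> = (\<Sum>k\<in>UNIV. (w k * (column k A \<bullet> x)) *\<^sub>R column k A) $ i"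
        by (simp add: inner_vec_def column_def sum_distrib_left sum_distrib_right mult_ac)
      finally show "(M *v x) $ i = (\<Sum>k\<in>UNIV. (w k * (column k A \<bullet> x)) *\<^sub>R column k A) $ i" .
    qed
    also have "norm \<dots> \<le> (\<Sum>k\<in>UNIV. w k * (norm (column k A))\<^sup>2 * norm x)"
    proof (rule sum_norm_le)
      fix k
      have "norm ((w k * (column k A \<bullet> x)) *\<^sub>R column k A) =
          w k * norm (column k A) * \<bar>column k A \<bullet> x\<bar>"
        using nonneg by (simp add: abs_mult)
      also have "\<dots> \<le> w k * norm (column k A) * (norm (column k A) * norm x)"
        using nonneg by (intro mult_left_mono Cauchy_Schwarz_ineq2) simp
      finally show "norm ((w k * (column k A \<bullet> x)) *\<^sub>R column k A)
          \<le> w k * (norm (column k A))\<^sup>2 * norm x"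
        by (simp add: power2_eq_square mult_ac)
    qed
    finally show ?thesis
      by (simp add: tr sum_distrib_right)
  qed
  then show ?thesis
    unfolding spectral_norm_def by (rule onorm_bound[rotated])
      (simp add: tr nonneg sum_nonneg)
qed

section \<open>Largest row entries and column lengths\<close>

lemma abs_entry_le_rho_row: "\<bar>A $ i $ j\<bar> \<le> rho_row A i"
  using component_le_infnorm_cart[of "row i A" j] by (simp add: rho_row_def row_def)

lemma norm_column_le_rho: "norm (column j A) \<le> rho A"
  unfolding rho_def by (intro Max_ge) auto

lemma rho_pos:
  assumes "A \<noteq> 0"
  shows "rho A > 0"
proof -
  obtain i j where "A $ i $ j \<noteq> 0"
    using assms by (auto simp: vec_eq_iff)
  then have "column j A \<noteq> 0"
    by (auto simp: vec_eq_iff column_def)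
  then show ?thesis
    using norm_column_le_rho[of j A] by (meson less_le_trans zero_less_norm_iff)
qed

lemma rho_row_le_rho: "rho_row A i \<le> rho A"
proof -
  have "\<bar>row i A $ j\<bar> \<le> rho A" for j
    using component_le_norm_cart[of "column j A" i] norm_column_le_rho[of j A]
    by (simp add: row_def column_def)
  then show ?thesis
    unfolding rho_row_def infnorm_cart by (intro cSup_least) auto
qed

lemma rho_row_nonneg: "rho_row A i \<ge> 0"
  by (simp add: rho_row_def infnorm_pos_le)

text \<open>
  Below: each entry of the longest column is at most the largest entry of its row. Above: the
  largest entry of a row lies in some column, so its absolute value is at most \<open>rho\<close>.
\<close>
lemma d_A_bounds:
  fixes A :: "real^'n::finite^'m::finite"
  assumes "A \<noteq> 0"
  shows "d_A A \<in> {1..real CARD('m)}"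
proof -
  have "rho A \<in> range (\<lambda>j. norm (column j A))"
    unfolding rho_def by (intro Max_in) auto
  then obtain j where "rho A = norm (column j A)"
    by blast
  then have "(rho A)\<^sup>2 = (\<Sum>i\<in>UNIV. (A $ i $ j)\<^sup>2)"
    by (simp only: power2_norm_eq_inner) (simp add: inner_vec_def column_def power2_eq_square)
  also have "\<dots> \<le> (\<Sum>i\<in>UNIV. (rho_row A i)\<^sup>2)"
    by (intro sum_mono abs_le_square_iff[THEN iffD1])
      (simp add: rho_row_nonneg abs_entry_le_rho_row)
  finally have lower: "(rho A)\<^sup>2 \<le> (\<Sum>i\<in>UNIV. (rho_row A i)\<^sup>2)" .
  have "(\<Sum>i\<in>UNIV. (rho_row A i)\<^sup>2) \<le> real CARD('m) * (rho A)\<^sup>2"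
    by (rule sum_bounded_above) (intro power_mono rho_row_le_rho rho_row_nonneg)
  with lower show ?thesis
    using rho_pos[OF assms] by (simp add: d_A_def divide_simps)
qed

section \<open>The interpolation formula\<close>

lemma d_curv_interpolation:
  fixes A :: "real^'n::finite^'m::finite"
  assumes "\<gamma> > 0" "H \<noteq> 0" "A \<noteq> 0" "\<Delta> \<ge> 0"
  shows "d_curv A \<gamma> H \<Delta> =
    Delta_cross A \<gamma> H / (Delta_cross A \<gamma> H + \<Delta>) * d_H H
    + \<Delta> / (Delta_cross A \<gamma> H + \<Delta>) * d_A A"
proof -
  define s where "s = spectral_norm H"
  define r where "r = (rho A)\<^sup>2"
  define T where "T = trace H"
  define R where "R = (\<Sum>i\<in>UNIV. (rho_row A i)\<^sup>2)"
  define g where "g = \<gamma>\<^sup>2"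
  define L where "L = ln (2::real)"
  have pos: "s > 0" "r > 0" "g > 0" "L > 0"
    using assms spectral_norm_pos rho_pos[of A] by (auto simp: s_def r_def g_def L_def)
  have num: "(\<Sum>i\<in>UNIV. ell A \<gamma> H i \<Delta>) = 2 * L * T + 2 * \<Delta> * R / g"
    by (simp add: ell_def trace_def sum.distrib sum_distrib_left sum_divide_distrib
        T_def R_def g_def L_def)
  have D: "g * L * s + \<Delta> * r > 0"
    using pos assms(4) by (intro add_pos_nonneg) auto
  have "(2 * L * T + 2 * \<Delta> * R / g) / (2 * L * s + 2 * \<Delta> * r / g) =
      (g * L * T + \<Delta> * R) / (g * L * s + \<Delta> * r)"
  proof -
    have "2 * L * T + 2 * \<Delta> * R / g = 2 / g * (g * L * T + \<Delta> * R)"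
      "2 * L * s + 2 * \<Delta> * r / g = 2 / g * (g * L * s + \<Delta> * r)"
      using pos by (auto simp: field_simps)
    moreover have "2 / g \<noteq> 0"
      using pos by simp
    ultimately show ?thesis
      by (simp only: mult_divide_mult_cancel_left_if if_False)
  qed
  moreover have "g * L * s / r / (g * L * s / r + \<Delta>) * (T / s) + \<Delta> / (g * L * s / r + \<Delta>) * (R / r)
      = (g * L * T + \<Delta> * R) / (g * L * s + \<Delta> * r)"
  proof -
    define E where "E = g * L * s + \<Delta> * r"
    have E: "g * L * s / r + \<Delta> = E / r"
      using pos by (simp add: E_def field_simps)
    show ?thesis
      unfolding E E_def[symmetric] using pos D[folded E_def] by (simp add: add_divide_distrib)
  qed
  ultimately show ?thesis
    unfolding d_curv_def num ell_full_def Delta_cross_def d_H_def d_A_def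
    unfolding s_def[symmetric] r_def[symmetric] T_def[symmetric] R_def[symmetric]
      g_def[symmetric] L_def[symmetric]
    by simp
qed

theorem propositionI1:
  fixes A :: "real^'n::finite^'m::finite" and b :: "real^'m" and c :: "real^'n"
    and \<gamma> :: real and lam :: "real^'m" and H :: "real^'m^'m"
  assumes gamma_pos: "\<gamma> > 0"
    and dual_normalization: "\<exists>q :: real^'m. transpose A *v q = vec 1 \<and> q \<bullet> b = 1"
    and primal_interior: "\<exists>x :: real^'n. (\<forall>j. x $ j > 0) \<and> A *v x = b"
    and minimizer: "is_arg_min (phi_se A b c \<gamma>) (\<lambda>_. True) lam"
    and H_eq: "H = hessian (phi_se A b c \<gamma>) lam"
    and H_nonzero: "H \<noteq> 0"
  shows "(\<forall>\<Delta>\<ge>0. d_curv A \<gamma> H \<Delta> =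
            Delta_cross A \<gamma> H / (Delta_cross A \<gamma> H + \<Delta>) * d_H H
            + \<Delta> / (Delta_cross A \<gamma> H + \<Delta>) * d_A A)
       \<and> d_H H \<in> {1..real CARD('m)}
       \<and> d_A A \<in> {1..real CARD('m)}
       \<and> d_curv A \<gamma> H 0 = d_H H
       \<and> (d_curv A \<gamma> H \<longlongrightarrow> d_A A) at_top"
proof -
  have A_nonzero: "A \<noteq> 0"
    using dual_normalization by (force simp: vec_eq_iff matrix_vector_mult_def transpose_def)
  let ?K = "Delta_cross A \<gamma> H"
  have gram: "H $ i $ j = (\<Sum>k\<in>UNIV. exp ((column k A \<bullet> lam - c $ k) / \<gamma>) / \<gamma> *
      (A $ i $ k * A $ j $ k))" for i j
    unfolding H_eq using gamma_pos by (rule hessian_phi_se)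
  have s_pos: "spectral_norm H > 0"
    using H_nonzero by (rule spectral_norm_pos)
  have "spectral_norm H \<le> trace H"
    using gamma_pos by (intro spectral_norm_gram_le_trace[OF gram]) simp
  then have dH: "d_H H \<in> {1..real CARD('m)}"
    using s_pos trace_le_card_spectral_norm[of H] by (simp add: d_H_def divide_simps)
  note interp = d_curv_interpolation[OF gamma_pos H_nonzero A_nonzero]
  have K_pos: "?K > 0"
    using s_pos rho_pos[OF A_nonzero] gamma_pos by (simp add: Delta_cross_def)
  have at_0: "d_curv A \<gamma> H 0 = d_H H"
    using interp[of 0] K_pos by simp
  have "((\<lambda>\<Delta>. k / (k + \<Delta>) * d_H H + \<Delta> / (k + \<Delta>) * d_A A) \<longlongrightarrow> 0 * d_H H + 1 * d_A A) at_top"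
    for k :: real
    by (intro tendsto_intros; real_asymp)
  then have "((\<lambda>\<Delta>. ?K / (?K + \<Delta>) * d_H H + \<Delta> / (?K + \<Delta>) * d_A A) \<longlongrightarrow> d_A A) at_top"
    by simp
  moreover have "\<forall>\<^sub>F \<Delta> in at_top. ?K / (?K + \<Delta>) * d_H H + \<Delta> / (?K + \<Delta>) * d_A A = d_curv A \<gamma> H \<Delta>"
    using eventually_ge_at_top[of 0] by eventually_elim (simp add: interp)
  ultimately have "(d_curv A \<gamma> H \<longlongrightarrow> d_A A) at_top"
    by (rule Lim_transform_eventually)
  with interp dH d_A_bounds[OF A_nonzero] at_0 show ?thesis
    by blast
qed

end
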